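(* Let $K$ be an imperfect field of characteristic $2$ and $L$ an additive subgroup of $K$ with $K^2\le L\le K$ which is a vector space over $K^2$. Let $\mathrm{SL}_2(L)$ be the subgroup of $\mathrm{SL}_2(K)$ generated by the matrices $a(t)=\begin{pmatrix}1&t\\0&1\end{pmatrix}$ and $b(t)=\begin{pmatrix}1&0\\t&1\end{pmatrix}$ for $t\in L$, and let $A=\{a(t):t\in L\}$. Let $T(L)$ be the group of diagonal matrices $\mathrm{Diag}(s,s^{-1})$ with $s$ in the multiplicative subgroup of $K^\times$ generated by $L^*=L\setminus\{0\}$, let $w=\begin{pmatrix}0&1\\-1&0\end{pmatrix}$, $B=T(L)A$ and $N=T(L)\langle w\rangle$. Then \[\mathrm{SL}_2(L)=B\cup BwB.\] In particular, $A$ is the group of upper unitriangular matrices in $\mathrm{SL}_2(L)$ and $T(L)$ is the group of diagonal matrices in $\mathrm{SL}_2(L)$. Furthermore, $\mathrm{SL}_2(L)$ is simple. *)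

theory Defs
  imports "HOL-Analysis.Analysis" "HOL-Algebra.Generated_Groups"
begin

text \<open>Both parts are needed: a field of characteristic 0 is perfect. In characteristic p > 0,
  perfect means that the Frobenius map is onto.\<close>

definition imperfect_field :: "'k::field itself \<Rightarrow> bool" where
  "imperfect_field _ \<longleftrightarrow> CHAR('k) > 0 \<and> range (\<lambda>x::'k. x ^ CHAR('k)) \<noteq> UNIV"

definition squares :: "'k::field set" where
  "squares = range (\<lambda>x. x\<^sup>2)"

definition units_group :: "'k::field monoid" where
  "units_group = \<lparr>carrier = UNIV - {0}, mult = (*), one = 1\<rparr>"

definition mat2 :: "'k \<Rightarrow> 'k \<Rightarrow> 'k \<Rightarrow> 'k \<Rightarrow> 'k::field ^ 2 ^ 2" where
  "mat2 p q r s = vector [vector [p, q], vector [r, s]]"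

definition SL2 :: "('k::field ^ 2 ^ 2) monoid" where
  "SL2 = \<lparr>carrier = {M. det M = 1}, mult = (**), one = mat 1\<rparr>"

definition a_mat :: "'k::field \<Rightarrow> 'k ^ 2 ^ 2" where
  "a_mat t = mat2 1 t 0 1"

definition b_mat :: "'k::field \<Rightarrow> 'k ^ 2 ^ 2" where
  "b_mat t = mat2 1 0 t 1"

definition SL2_gen :: "'k::field set \<Rightarrow> ('k ^ 2 ^ 2) set" where
  "SL2_gen L = generate SL2 (a_mat ` L \<union> b_mat ` L)"

definition A_grp :: "'k::field set \<Rightarrow> ('k ^ 2 ^ 2) set" where
  "A_grp L = a_mat ` L"

definition T_grp :: "'k::field set \<Rightarrow> ('k ^ 2 ^ 2) set" where
  "T_grp L = (\<lambda>s. mat2 s 0 0 (inverse s)) ` generate units_group (L - {0})"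

definition w_mat :: "'k::field ^ 2 ^ 2" where
  "w_mat = mat2 0 1 (- 1) 0"

definition B_grp :: "'k::field set \<Rightarrow> ('k ^ 2 ^ 2) set" where
  "B_grp L = T_grp L <#>\<^bsub>SL2\<^esub> A_grp L"

text \<open>The companion of \<open>B_grp\<close> in the BN-pair; the Bruhat decomposition itself only involves
  \<open>w_mat\<close>.\<close>

definition N_grp :: "'k::field set \<Rightarrow> ('k ^ 2 ^ 2) set" where
  "N_grp L = T_grp L <#>\<^bsub>SL2\<^esub> generate SL2 {w_mat}"

definition upper_unitriangular :: "'k::field ^ 2 ^ 2 \<Rightarrow> bool" where
  "upper_unitriangular M \<longleftrightarrow> (\<exists>t. M = mat2 1 t 0 1)"

definition diagonal :: "'k::field ^ 2 ^ 2 \<Rightarrow> bool" where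
  "diagonal M \<longleftrightarrow> (\<exists>p s. M = mat2 p 0 0 s)"

text \<open>The locale \<open>simple_group\<close> of HOL-Algebra demands \<open>order G > 1\<close>, and \<open>order G = 0\<close> for an
  infinite carrier, so no infinite group satisfies it. Nontriviality is therefore stated
  directly here.\<close>

definition is_simple :: "('g, 'm) monoid_scheme \<Rightarrow> bool" where
  "is_simple G \<longleftrightarrow> group G \<and> carrier G \<noteq> {\<one>\<^bsub>G\<^esub>} \<and>
     (\<forall>H. H \<lhd> G \<longrightarrow> H = carrier G \<or> H = {\<one>\<^bsub>G\<^esub>})"

end

theory Submission
  imports Defs "HOL-Algebra.SndIsomorphismGrp"
begin

text \<open>\<open>B\<close> and \<open>BwB\<close> have explicit parametrizations by \<open>T(L)\<close> and \<open>L\<close>, from which their union is seen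
  to be closed under left multiplication by \<open>a(t)\<close> and by \<open>w\<close>, hence by \<open>b(t) = w a(t) w\<close>
  (in characteristic 2, \<open>-1 = 1\<close> and \<open>w\<close> is an involution); this is the Bruhat decomposition.
  For simplicity, a nontrivial normal subgroup \<open>H\<close> has an element in \<open>BwB\<close> and a conjugate of it
  shows that \<open>w\<close> lies in \<open>HB\<close>. As \<open>B\<close> normalizes \<open>A\<close>, every \<open>b(t)\<close> lies in \<open>HA\<close>, so \<open>G = HA\<close> and
  \<open>G/H\<close> is abelian. The commutators \<open>[Diag(s, 1/s), a(t)] = a((1 + s)\<^sup>2 t)\<close> with \<open>s \<noteq> 1\<close> exhaust \<open>A\<close>,
  so \<open>H\<close> contains \<open>A\<close>, its conjugate \<open>wAw\<close>, and therefore \<open>G\<close>.\<close>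

section \<open>Two-by-two matrices and the ambient groups\<close>

lemma mat2_nth [simp]:
  "mat2 p q r s $ 1 $ 1 = p" "mat2 p q r s $ 1 $ 2 = q"
  "mat2 p q r s $ 2 $ 1 = r" "mat2 p q r s $ 2 $ 2 = s"
  by (simp_all add: mat2_def)

lemma mat2_eq_iff [simp]:
  "mat2 p q r s = mat2 p' q' r' s' \<longleftrightarrow> p = p' \<and> q = q' \<and> r = r' \<and> s = s'"
  by (auto simp: vec_eq_iff forall_2)

lemma mat2_cases: obtains p q r s where "M = mat2 p q r s"
proof
  show "M = mat2 (M $ 1 $ 1) (M $ 1 $ 2) (M $ 2 $ 1) (M $ 2 $ 2)"
    by (simp add: vec_eq_iff forall_2)
qed

lemma mat2_mult [simp]:
  "mat2 p q r s ** mat2 p' q' r' s' =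
     mat2 (p * p' + q * r') (p * q' + q * s') (r * p' + s * r') (r * q' + s * s')"
  by (simp add: vec_eq_iff forall_2 matrix_matrix_mult_def sum_2)

lemma det_mat2 [simp]: "det (mat2 p q r s) = p * s - q * r"
  by (simp add: det_2)

lemma mat2_one: "mat 1 = mat2 1 0 0 1"
  by (simp add: vec_eq_iff forall_2 mat_def)

lemma SL2_simps [simp]:
  "x \<otimes>\<^bsub>SL2\<^esub> y = x ** y" "\<one>\<^bsub>SL2\<^esub> = mat2 1 0 0 1"
  "x \<in> carrier SL2 \<longleftrightarrow> det x = 1"
  by (simp_all add: SL2_def mat2_one)

lemma group_SL2: "group (SL2 :: ('k::field ^ 2 ^ 2) monoid)"
proof (rule groupI)
  fix x :: "'k ^ 2 ^ 2" assume x: "x \<in> carrier SL2"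
  obtain p q r s where xe: "x = mat2 p q r s" by (rule mat2_cases)
  show "\<exists>y\<in>carrier SL2. y \<otimes>\<^bsub>SL2\<^esub> x = \<one>\<^bsub>SL2\<^esub>"
    using x by (intro bexI[of _ "mat2 s (- q) (- r) p"]) (auto simp: xe algebra_simps)
  show "\<one>\<^bsub>SL2\<^esub> \<otimes>\<^bsub>SL2\<^esub> x = x" by (simp add: xe)
qed (auto simp: det_mul matrix_mul_assoc)

interpretation SL2: group SL2 by (rule group_SL2)

lemma SL2_inv:
  assumes "p * s - q * r = 1"
  shows "inv\<^bsub>SL2\<^esub> (mat2 p q r s) = mat2 s (- q) (- r) p"
  using assms by (intro SL2.inv_equality) (auto simp: algebra_simps)

lemma group_units_group: "group (units_group :: 'k::field monoid)"
proof (rule groupI)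
  fix x :: 'k assume "x \<in> carrier units_group"
  then show "\<exists>y\<in>carrier units_group. y \<otimes>\<^bsub>units_group\<^esub> x = \<one>\<^bsub>units_group\<^esub>"
    by (intro bexI[of _ "inverse x"]) (auto simp: units_group_def)
qed (auto simp: units_group_def)

section \<open>Vector spaces over the squares in characteristic 2\<close>

locale square_module =
  fixes L :: "'k::field set"
  assumes char2: "CHAR('k) = 2"
    and L_zero [simp]: "0 \<in> L"
    and L_add: "\<And>x y. x \<in> L \<Longrightarrow> y \<in> L \<Longrightarrow> x + y \<in> L"
    and squares_L: "squares \<subseteq> L"
    and squares_mult_L: "\<And>c x. c \<in> squares \<Longrightarrow> x \<in> L \<Longrightarrow> c * x \<in> L"
begin

text \<open>As simp rules these erase all signs; each of \<open>a(t)\<close>, \<open>b(t)\<close>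
  and \<open>w\<close> becomes its own inverse.\<close>

lemmas uminus_eq [simp] = uminus_CHAR_2[OF char2] and minus_eq [simp] = minus_CHAR_2[OF char2]

lemma two_eq_zero [simp]: "(2::'k) = 0"
  using of_nat_CHAR[where ?'a = 'k] by (simp add: char2)

lemma double_zero [simp]: "(x::'k) + x = 0"
  by (simp flip: mult_2)

lemma square_eq_one_iff: "x * x = 1 \<longleftrightarrow> x = (1::'k)"
  by (metis square_eq_1_iff uminus_eq)

lemma L_square_mult: "x \<in> L \<Longrightarrow> c * (c * x) \<in> L"
  using squares_mult_L[of "c\<^sup>2" x] by (auto simp: squares_def power2_eq_square mult.assoc)

lemma L_one [simp]: "1 \<in> L"
  using squares_L rangeI[of "\<lambda>x::'k. x\<^sup>2" 1] by (auto simp: squares_def)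

text \<open>\<open>1/x\<close> is \<open>x\<close> times the square of \<open>1/x\<close>; at 0 the
  convention \<open>inverse 0 = 0\<close> applies.\<close>

lemma L_inverse: "x \<in> L \<Longrightarrow> inverse x \<in> L"
  using L_square_mult[of x "inverse x"] by (cases "x = 0") auto

text \<open>The parameter group of the torus \<open>T(L)\<close>.\<close>

definition D :: "'k set" where "D = generate units_group (L - {0})"

lemma subgroup_D: "subgroup D units_group"
  unfolding D_def by (rule group.generate_is_subgroup[OF group_units_group]) (auto simp: units_group_def)

lemma D_nonzero: "s \<in> D \<Longrightarrow> s \<noteq> 0"
  using subgroup.subset[OF subgroup_D] by (auto simp: units_group_def)

lemma D_mult: "s \<in> D \<Longrightarrow> t \<in> D \<Longrightarrow> s * t \<in> D"
  using subgroup.m_closed[OF subgroup_D] by (auto simp: units_group_def)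

lemma D_inverse: "s \<in> D \<Longrightarrow> inverse s \<in> D"
proof -
  assume s: "s \<in> D"
  have "inv\<^bsub>units_group\<^esub> s = inverse s"
    using D_nonzero[OF s]
    by (intro group.inv_equality[OF group_units_group]) (auto simp: units_group_def)
  then show ?thesis using subgroup.m_inv_closed[OF subgroup_D s] by simp
qed

lemma D_incl: "t \<in> L \<Longrightarrow> t \<noteq> 0 \<Longrightarrow> t \<in> D"
  by (auto simp: D_def intro: generate.incl)

lemma D_one: "1 \<in> D" by (rule D_incl) auto

lemma T_grp_eq: "T_grp L = (\<lambda>s. mat2 s 0 0 (inverse s)) ` D"
  by (simp add: T_grp_def D_def)

section \<open>Parametrizations of \<open>B\<close> and \<open>BwB\<close>\<close>

lemma B_grp_iff: "M \<in> B_grp L \<longleftrightarrow> (\<exists>s\<in>D. \<exists>t\<in>L. M = mat2 s (s * t) 0 (inverse s))"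
  by (auto simp: B_grp_def T_grp_eq A_grp_def a_mat_def set_mult_def)

definition big_cell :: "('k ^ 2 ^ 2) set" where
  "big_cell = (B_grp L #>\<^bsub>SL2\<^esub> w_mat) <#>\<^bsub>SL2\<^esub> B_grp L"

text \<open>The matrix is \<open>Diag(s, 1/s) a(t) w a(u)\<close>: the torus part of the right
  factor \<open>B\<close> can be moved to the front.\<close>

lemma big_cell_iff: "M \<in> big_cell \<longleftrightarrow> (\<exists>s\<in>D. \<exists>t\<in>L. \<exists>u\<in>L.
    M = mat2 (s * t) (s * (1 + t * u)) (inverse s) (inverse s * u))"
proof
  assume "M \<in> big_cell"
  then obtain s t s' t' where *: "s \<in> D" "t \<in> L" "s' \<in> D" "t' \<in> L"
    and M: "M = mat2 s (s * t) 0 (inverse s) ** w_mat ** mat2 s' (s' * t') 0 (inverse s')"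
    unfolding big_cell_def set_mult_def r_coset_def by (auto simp: B_grp_iff)
  show "\<exists>s\<in>D. \<exists>t\<in>L. \<exists>u\<in>L. M = mat2 (s * t) (s * (1 + t * u)) (inverse s) (inverse s * u)"
  \<comment> \<open>Passing \<open>w\<close> inverts \<open>Diag(s', 1/s')\<close>; passing
    \<open>a(t)\<close> then rescales \<open>t\<close> by the square of \<open>s'\<close>, which
    keeps it in \<open>L\<close>.\<close>
  proof (rule bexI[of _ "s * inverse s'"], rule bexI[of _ "s' * (s' * t)"], rule bexI[of _ t'])
    show "M = mat2 (s * inverse s' * (s' * (s' * t))) (s * inverse s' * (1 + s' * (s' * t) * t'))
        (inverse (s * inverse s')) (inverse (s * inverse s') * t')"
      using * D_nonzero[of s] D_nonzero[of s'] by (simp add: M w_mat_def field_simps)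
  qed (use * in \<open>auto intro: D_mult D_inverse L_square_mult\<close>)
next
  assume "\<exists>s\<in>D. \<exists>t\<in>L. \<exists>u\<in>L. M = mat2 (s * t) (s * (1 + t * u)) (inverse s) (inverse s * u)"
  then obtain s t u where *: "s \<in> D" "t \<in> L" "u \<in> L"
    and M: "M = mat2 (s * t) (s * (1 + t * u)) (inverse s) (inverse s * u)" by blast
  have "M = mat2 s (s * t) 0 (inverse s) ** w_mat ** mat2 1 (1 * u) 0 (inverse 1)"
    by (simp add: M w_mat_def algebra_simps)
  moreover have "mat2 s (s * t) 0 (inverse s) \<in> B_grp L" "mat2 1 (1 * u) 0 (inverse 1) \<in> B_grp L"
    using * D_one by (auto simp: B_grp_iff)
  ultimately show "M \<in> big_cell" unfolding big_cell_def set_mult_def r_coset_def by fastforce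
qed

section \<open>Elements of the generated group\<close>

abbreviation G :: "('k ^ 2 ^ 2) set" where "G \<equiv> SL2_gen L"

lemma generators_carrier: "a_mat ` L \<union> b_mat ` L \<subseteq> carrier SL2"
  by (auto simp: a_mat_def b_mat_def)

lemma subgroup_G: "subgroup G SL2"
  unfolding SL2_gen_def by (rule SL2.generate_is_subgroup[OF generators_carrier])

lemma G_mult: "x \<in> G \<Longrightarrow> y \<in> G \<Longrightarrow> x ** y \<in> G"
  using subgroup.m_closed[OF subgroup_G] by simp

lemma a_in_G: "t \<in> L \<Longrightarrow> mat2 1 t 0 1 \<in> G" and b_in_G: "t \<in> L \<Longrightarrow> mat2 1 0 t 1 \<in> G"
  by (auto simp: SL2_gen_def a_mat_def b_mat_def intro: generate.incl)

text \<open>This is \<open>a(t) b(1/t) a(t)\<close>. The case \<open>t = 1\<close> is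
  \<open>w\<close>, and products with \<open>w\<close> yield the torus.\<close>

lemma antidiagonal_in_G:
  assumes "t \<in> L" "t \<noteq> 0"
  shows "mat2 0 t (inverse t) 0 \<in> G"
proof -
  have "mat2 1 t 0 1 ** mat2 1 0 (inverse t) 1 ** mat2 1 t 0 1 \<in> G"
    using assms by (intro G_mult a_in_G b_in_G L_inverse)
  then show ?thesis using assms by simp
qed

lemma w_in_G: "w_mat \<in> G"
  using antidiagonal_in_G[of 1] by (simp add: w_mat_def)

lemma diag_in_G: "s \<in> D \<Longrightarrow> mat2 s 0 0 (inverse s) \<in> G"
  unfolding D_def
proof (induction rule: generate.induct)
  case one
  then show ?case using a_in_G[of 0] by (simp add: units_group_def)
next
  case (incl h)
  then have "mat2 0 h (inverse h) 0 ** mat2 0 1 1 0 \<in> G"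
    using antidiagonal_in_G[of h] antidiagonal_in_G[of 1] by (intro G_mult) auto
  then show ?case by simp
next
  case (inv h)
  have "inv\<^bsub>units_group\<^esub> h = inverse h"
    using inv by (intro group.inv_equality[OF group_units_group]) (auto simp: units_group_def)
  moreover have "mat2 0 1 1 0 ** mat2 0 h (inverse h) 0 \<in> G"
    using inv antidiagonal_in_G[of h] antidiagonal_in_G[of 1] by (intro G_mult) auto
  ultimately show ?case by simp
next
  case (eng x y)
  then show ?case using G_mult[OF eng.IH] by (simp add: units_group_def mult.commute)
qed

lemma B_subset_G: "B_grp L \<subseteq> G"
proof
  fix M assume "M \<in> B_grp L"
  then obtain s t where *: "s \<in> D" "t \<in> L" "M = mat2 s (s * t) 0 (inverse s)"
    by (auto simp: B_grp_iff)
  show "M \<in> G" using G_mult[OF diag_in_G[OF *(1)] a_in_G[OF *(2)]] by (simp add: *)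
qed

lemma big_cell_subset_G: "big_cell \<subseteq> G"
  using B_subset_G w_in_G by (auto simp: big_cell_def set_mult_def r_coset_def intro!: G_mult)

section \<open>Bruhat decomposition\<close>

lemma a_mult_closed:
  assumes v: "v \<in> L" and M: "M \<in> B_grp L \<union> big_cell"
  shows "mat2 1 v 0 1 ** M \<in> B_grp L \<union> big_cell"
  using M
proof
  assume "M \<in> B_grp L"
  then obtain s t where *: "s \<in> D" "t \<in> L" "M = mat2 s (s * t) 0 (inverse s)"
    by (auto simp: B_grp_iff)
  \<comment> \<open>Moving \<open>a(v)\<close> past \<open>Diag(s, 1/s)\<close> divides
    \<open>v\<close> by the square of \<open>s\<close>, so only \<open>t\<close> is shifted; the
    same happens in the big cell.\<close>
  have "mat2 1 v 0 1 ** M = mat2 s (s * (t + inverse s * (inverse s * v))) 0 (inverse s)"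
    using D_nonzero[OF *(1)] by (simp add: * field_simps)
  moreover have "t + inverse s * (inverse s * v) \<in> L" using * v by (intro L_add L_square_mult)
  ultimately show ?thesis using * unfolding Un_iff B_grp_iff by blast
next
  assume "M \<in> big_cell"
  then obtain s t u where *: "s \<in> D" "t \<in> L" "u \<in> L"
    "M = mat2 (s * t) (s * (1 + t * u)) (inverse s) (inverse s * u)"
    by (auto simp: big_cell_iff)
  let ?t = "t + inverse s * (inverse s * v)"
  have "mat2 1 v 0 1 ** M = mat2 (s * ?t) (s * (1 + ?t * u)) (inverse s) (inverse s * u)"
    using D_nonzero[OF *(1)] by (simp add: * field_simps)
  moreover have "?t \<in> L" using * v by (intro L_add L_square_mult)
  ultimately show ?thesis using * unfolding Un_iff big_cell_iff by blast
qed

text \<open>Passing \<open>w\<close> inverts the torus factor. On the big cell,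
  \<open>w a(t) w = b(t)\<close> remains, which is trivial for \<open>t = 0\<close> and equals
  \<open>Diag(1/t, t) a(t) w a(1/t)\<close> otherwise.\<close>

lemma w_mult_closed:
  assumes M: "M \<in> B_grp L \<union> big_cell"
  shows "w_mat ** M \<in> B_grp L \<union> big_cell"
  using M
proof
  assume "M \<in> B_grp L"
  then obtain s t where *: "s \<in> D" "t \<in> L" "M = mat2 s (s * t) 0 (inverse s)"
    by (auto simp: B_grp_iff)
  have "w_mat ** M = mat2 (inverse s * 0) (inverse s * (1 + 0 * t)) (inverse (inverse s))
      (inverse (inverse s) * t)"
    by (simp add: * w_mat_def)
  then show ?thesis using * D_inverse L_zero unfolding Un_iff big_cell_iff by blast
next
  assume "M \<in> big_cell"
  then obtain s t u where *: "s \<in> D" "t \<in> L" "u \<in> L"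
    "M = mat2 (s * t) (s * (1 + t * u)) (inverse s) (inverse s * u)"
    by (auto simp: big_cell_iff)
  show ?thesis
  proof (cases "t = 0")
    case True
    have "w_mat ** M = mat2 (inverse s) (inverse s * u) 0 (inverse (inverse s))"
      by (simp add: * w_mat_def True)
    then show ?thesis using * D_inverse unfolding Un_iff B_grp_iff by blast
  next
    case False
    \<comment> \<open>Read off from \<open>Diag(1/s, s) b(t) a(u)\<close> after factoring
      \<open>b(t)\<close>.\<close>
    let ?s = "inverse s * inverse t" and ?u = "u + inverse t"
    have "w_mat ** M = mat2 (?s * t) (?s * (1 + t * ?u)) (inverse ?s) (inverse ?s * ?u)"
      using D_nonzero[OF *(1)] False by (simp add: * w_mat_def field_simps)
    moreover have "?s \<in> D" "?u \<in> L"
      using * False by (auto intro: D_mult D_inverse D_incl L_add L_inverse simp del: inverse_mult_distrib)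
    ultimately show ?thesis using * unfolding Un_iff big_cell_iff by blast
  qed
qed

lemma b_mat_conj: "mat2 1 0 v (1::'k) = w_mat ** mat2 1 v 0 1 ** w_mat"
  by (simp add: w_mat_def)

lemma b_mult_closed:
  assumes "v \<in> L" "M \<in> B_grp L \<union> big_cell"
  shows "mat2 1 0 v 1 ** M \<in> B_grp L \<union> big_cell"
  using w_mult_closed[OF a_mult_closed[OF assms(1) w_mult_closed[OF assms(2)]]]
  by (simp add: b_mat_conj matrix_mul_assoc)

lemma G_eq: "G = B_grp L \<union> big_cell"
proof
  \<comment> \<open>Closure under left multiplication by \<open>M\<close>, unlike mere membership of
    \<open>M\<close>, passes to products in the induction; applied to the identity it gives
    membership.\<close>
  have "\<forall>x\<in>B_grp L \<union> big_cell. M ** x \<in> B_grp L \<union> big_cell" if "M \<in> G" for M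
    using that unfolding SL2_gen_def
  proof (induction rule: generate.induct)
    case one
    then show ?case by (simp flip: mat2_one)
  next
    case (incl h)
    then show ?case using a_mult_closed b_mult_closed by (force simp: a_mat_def b_mat_def)
  next
    case (inv h)
    then show ?case using a_mult_closed b_mult_closed by (force simp: a_mat_def b_mat_def SL2_inv)
  next
    case (eng x y)
    then show ?case by (simp flip: matrix_mul_assoc)
  qed
  moreover have "mat 1 \<in> B_grp L"
    using D_one by (auto simp: B_grp_iff mat2_one intro!: bexI[of _ 1] bexI[of _ 0])
  ultimately show "G \<subseteq> B_grp L \<union> big_cell" by (metis UnI1 matrix_mul_rid subsetI)
  show "B_grp L \<union> big_cell \<subseteq> G" using B_subset_G big_cell_subset_G by blast
qed

section \<open>Unitriangular and diagonal elements\<close>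

lemma A_grp_eq: "A_grp L = {M \<in> G. upper_unitriangular M}"
proof (intro equalityI subsetI)
  fix M assume "M \<in> A_grp L"
  then show "M \<in> {M \<in> G. upper_unitriangular M}"
    using a_in_G by (auto simp: A_grp_def a_mat_def upper_unitriangular_def)
next
  fix M assume "M \<in> {M \<in> G. upper_unitriangular M}"
  \<comment> \<open>The big cell is excluded by its lower left entry \<open>1/s\<close>, which is
    nonzero.\<close>
  then show "M \<in> A_grp L"
    using D_nonzero
    by (auto simp: G_eq B_grp_iff big_cell_iff A_grp_def a_mat_def upper_unitriangular_def)
qed

lemma T_grp_eq_diagonal: "T_grp L = {M \<in> G. diagonal M}"
proof (intro equalityI subsetI)
  fix M assume "M \<in> T_grp L"
  then show "M \<in> {M \<in> G. diagonal M}"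
    using diag_in_G by (auto simp: T_grp_eq diagonal_def)
next
  fix M assume "M \<in> {M \<in> G. diagonal M}"
  then show "M \<in> T_grp L"
    using D_nonzero by (auto simp: G_eq B_grp_iff big_cell_iff T_grp_eq diagonal_def)
qed

section \<open>Normal subgroups and simplicity\<close>

abbreviation SG :: "('k ^ 2 ^ 2) monoid" where "SG \<equiv> SL2\<lparr>carrier := G\<rparr>"

lemma group_SG: "group SG"
  by (rule subgroup.subgroup_is_group[OF subgroup_G group_SL2])

lemma subgroup_A: "subgroup (A_grp L) SG"
proof (rule group.subgroupI[OF group_SG])
  show "A_grp L \<subseteq> carrier SG" using a_in_G by (auto simp: A_grp_def a_mat_def)
  show "A_grp L \<noteq> {}" using L_zero unfolding A_grp_def by blast
  show "inv\<^bsub>SG\<^esub> x \<in> A_grp L" if "x \<in> A_grp L" for x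
  proof -
    have "inv\<^bsub>SG\<^esub> x = x"
      using that a_in_G
      by (intro group.inv_equality[OF group_SG]) (auto simp: A_grp_def a_mat_def)
    then show ?thesis using that by simp
  qed
  show "x \<otimes>\<^bsub>SG\<^esub> y \<in> A_grp L" if "x \<in> A_grp L" "y \<in> A_grp L" for x y
    using that by (auto simp: A_grp_def a_mat_def intro: L_add)
qed

context
  fixes H
  assumes H: "H \<lhd> SG"
begin

text \<open>The inverse enters as an explicit matrix \<open>g'\<close>, so that conjugates can be
  computed entrywise.\<close>

lemma H_conj:
  assumes "h \<in> H" "g \<in> G" "g' \<in> G" "g' ** g = mat2 1 0 0 1"
  shows "g ** h ** g' \<in> H"
proof -
  have "inv\<^bsub>SG\<^esub> g = g'"
    using assms by (intro group.inv_equality[OF group_SG]) auto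
  then show ?thesis using normal.inv_op_closed2[OF H, of g h] assms by simp
qed

lemma subgroup_H: "subgroup H SG"
  using H by (rule normal_imp_subgroup)

lemma H_subset_G: "H \<subseteq> G"
  using subgroup.subset[OF subgroup_H] by simp

text \<open>\<open>G\<close> is generated inside \<open>SL2\<close>, so \<open>K\<close> is first
  viewed as a subgroup of \<open>SL2\<close>.\<close>

lemma subgroup_contains_G:
  assumes "subgroup K SG" "a_mat ` L \<union> b_mat ` L \<subseteq> K"
  shows "G \<subseteq> K"
  unfolding SL2_gen_def
  using assms SL2.incl_subgroup[OF subgroup_G] by (intro SL2.generate_subgroup_incl)

text \<open>Conjugation by \<open>w\<close> moves \<open>q\<close> to the lower left corner, and
  elements of \<open>B\<close> have 0 there.\<close>

lemma H_meets_big_cell_if_upper: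
  assumes M: "mat2 p q 0 s \<in> H" and q: "q \<noteq> 0"
  shows "\<exists>h\<in>H. h \<in> big_cell"
proof -
  have "w_mat ** mat2 p q 0 s ** w_mat \<in> H"
    by (rule H_conj[OF M w_in_G w_in_G]) (simp add: w_mat_def)
  then have "mat2 s 0 q p \<in> H" by (simp add: w_mat_def)
  moreover have "mat2 s 0 q p \<notin> B_grp L" using q by (auto simp: B_grp_iff)
  ultimately show ?thesis using H_subset_G G_eq by blast
qed

lemma H_meets_big_cell:
  assumes "H \<noteq> {\<one>\<^bsub>SG\<^esub>}"
  shows "\<exists>h\<in>H. h \<in> big_cell"
proof -
  obtain h where h: "h \<in> H" "h \<noteq> mat2 1 0 0 1"
    using assms subgroup.one_closed[OF subgroup_H] by auto
  show ?thesis
  proof (cases "h \<in> big_cell")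
    case False
    then obtain s t where *: "s \<in> D" "t \<in> L" "h = mat2 s (s * t) 0 (inverse s)"
      using h H_subset_G G_eq B_grp_iff by blast
    show ?thesis
    proof (cases "t = 0")
      case True
      \<comment> \<open>Conjugating a diagonal element by \<open>a(1)\<close> creates the upper
        right entry \<open>s + 1/s\<close>; it vanishes only for \<open>s = 1\<close>, that is, for
        \<open>h = 1\<close>.\<close>
      have "mat2 1 1 0 1 ** h ** mat2 1 1 0 1 \<in> H"
        by (rule H_conj[OF h(1)]) (auto intro: a_in_G)
      then have "mat2 s (s + inverse s) 0 (inverse s) \<in> H" by (simp add: * True)
      moreover have "s + inverse s \<noteq> 0"
      proof
        assume "s + inverse s = 0"
        then have "s * s = 1"
          using D_nonzero[OF *(1)] by (metis add_eq_0_iff right_inverse uminus_eq)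
        then show False using h * True by (simp add: square_eq_one_iff)
      qed
      ultimately show ?thesis by (rule H_meets_big_cell_if_upper)
    next
      case False
      then show ?thesis
        using h * D_nonzero by (intro H_meets_big_cell_if_upper[of s "s * t" "inverse s"]) auto
    qed
  qed (use h in blast)
qed

text \<open>\<open>HA\<close> is a subgroup because \<open>H\<close> is normal, so the generators
  suffice. Some \<open>g\<close> in \<open>H\<close> with lower right entry 0 conjugates
  \<open>A\<close> to the lower unitriangular matrices, and conjugation by \<open>g\<close> is
  trivial modulo \<open>H\<close>.\<close>

lemma G_subset_HA:
  assumes "H \<noteq> {\<one>\<^bsub>SG\<^esub>}"
  shows "G \<subseteq> H <#>\<^bsub>SG\<^esub> A_grp L"
proof (rule subgroup_contains_G)
  interpret second_isomorphism_grp H SG "A_grp L"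
    using H subgroup_A by (simp add: second_isomorphism_grp_def second_isomorphism_grp_axioms_def)
  show "subgroup (H <#>\<^bsub>SG\<^esub> A_grp L) SG" by (rule normal_set_mult_subgroup)
  obtain h where h: "h \<in> H" "h \<in> big_cell" using H_meets_big_cell[OF assms] by blast
  then obtain s t u where *: "s \<in> D" "t \<in> L" "u \<in> L"
    "h = mat2 (s * t) (s * (1 + t * u)) (inverse s) (inverse s * u)"
    by (auto simp: big_cell_iff)
  have s: "s \<noteq> 0" using D_nonzero[OF *(1)] .
  define x where "x = s * t + u * inverse s"
  \<comment> \<open>Conjugation by \<open>a(u)\<close> absorbs the right factor of \<open>h = Diag(s, 1/s) a(t) w a(u)\<close>.\<close>
  have "mat2 1 u 0 1 ** h ** mat2 1 u 0 1 \<in> H"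
    by (rule H_conj[OF h(1)]) (use * in \<open>auto intro: a_in_G\<close>)
  also have "mat2 1 u 0 1 ** h ** mat2 1 u 0 1 = mat2 x s (inverse s) 0"
    by (simp add: * x_def algebra_simps)
  finally have g: "mat2 x s (inverse s) 0 \<in> H" .
  then have "inv\<^bsub>SG\<^esub> (mat2 x s (inverse s) 0) \<in> H"
    by (rule subgroup.m_inv_closed[OF subgroup_H])
  also have "inv\<^bsub>SG\<^esub> (mat2 x s (inverse s) 0) = mat2 0 s (inverse s) x"
    using g H_subset_G s SL2.m_inv_consistent[OF subgroup_G, of "mat2 x s (inverse s) 0"]
    by (auto simp: SL2_inv)
  finally have g': "mat2 0 s (inverse s) x \<in> H" .
  show "a_mat ` L \<union> b_mat ` L \<subseteq> H <#>\<^bsub>SG\<^esub> A_grp L"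
  proof (intro Un_least subsetI)
    fix M assume "M \<in> a_mat ` L"
    then have "M = mat2 1 0 0 1 \<otimes>\<^bsub>SG\<^esub> M" "M \<in> A_grp L"
      by (auto simp: a_mat_def A_grp_def)
    then show "M \<in> H <#>\<^bsub>SG\<^esub> A_grp L"
      using subgroup.one_closed[OF subgroup_H] unfolding set_mult_def by fastforce
  next
    fix M assume "M \<in> b_mat ` L"
    then obtain v where v: "v \<in> L" "M = mat2 1 0 v 1" by (auto simp: b_mat_def)
    \<comment> \<open>Chosen so that conjugating \<open>a(y)\<close> by the inverse of
      \<open>g = mat2 x s (inverse s) 0\<close> gives \<open>b(v)\<close>.\<close>
    define y where "y = s * (s * v)"
    have y: "y \<in> L" using v by (auto simp: y_def intro: L_square_mult)
    have "mat2 1 y 0 1 ** mat2 x s (inverse s) 0 ** mat2 1 y 0 1 \<in> H"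
      by (rule H_conj[OF g]) (use y in \<open>auto intro: a_in_G\<close>)
    then have "mat2 0 s (inverse s) x ** (mat2 1 y 0 1 ** mat2 x s (inverse s) 0 ** mat2 1 y 0 1) \<in> H"
      using subgroup.m_closed[OF subgroup_H g'] by (simp del: mat2_mult)
    \<comment> \<open>As \<open>a(y)\<close> squares to 1, the right-hand side is a commutator in
      \<open>H\<close> times \<open>a(y)\<close>.\<close>
    moreover have "M = mat2 0 s (inverse s) x **
        (mat2 1 y 0 1 ** mat2 x s (inverse s) 0 ** mat2 1 y 0 1) ** mat2 1 y 0 1"
      using s by (simp add: v y_def field_simps)
    moreover have "mat2 1 y 0 1 \<in> A_grp L" using y by (auto simp: A_grp_def a_mat_def)
    ultimately show "M \<in> H <#>\<^bsub>SG\<^esub> A_grp L" unfolding set_mult_def by fastforce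
  qed
qed

text \<open>Write \<open>g = h a(t)\<close> with \<open>h\<close> in \<open>H\<close>. Since
  \<open>a(t)\<close> commutes with \<open>a(v)\<close>, the commutator of \<open>g\<close> with
  \<open>a(v)\<close> equals that of \<open>h\<close> with \<open>a(v)\<close>.\<close>

lemma commutator_in_H:
  assumes nontriv: "H \<noteq> {\<one>\<^bsub>SG\<^esub>}" and g: "g \<in> G" "g' \<in> G" "g ** g' = mat2 1 0 0 1" and v: "v \<in> L"
  shows "g ** mat2 1 v 0 1 ** g' ** mat2 1 v 0 1 \<in> H"
proof -
  obtain h t where h: "h \<in> H" and t: "t \<in> L" and ge: "g = h ** mat2 1 t 0 1"
    using G_subset_HA[OF nontriv] g unfolding set_mult_def by (auto simp: A_grp_def a_mat_def)
  define h' where "h' = mat2 1 t 0 1 ** g'"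
  have hG: "h \<in> G" using h H_subset_G by blast
  have h'G: "h' \<in> G" unfolding h'_def using t g by (intro G_mult a_in_G)
  have hh': "h ** h' = mat2 1 0 0 1" using g by (simp add: h'_def ge matrix_mul_assoc)
  have "inv\<^bsub>SG\<^esub> h' = h"
    using hG h'G hh' by (intro group.inv_equality[OF group_SG]) auto
  then have "inv\<^bsub>SG\<^esub> h = h'" using group.inv_inv[OF group_SG, of h'] h'G by simp
  then have h': "h' \<in> H" using subgroup.m_inv_closed[OF subgroup_H h] by simp
  have g': "g' = mat2 1 t 0 1 ** h'"
    by (simp add: h'_def matrix_mul_assoc flip: mat2_one)
  have "mat2 1 v 0 1 ** h' ** mat2 1 v 0 1 \<in> H"
    by (rule H_conj[OF h']) (use v in \<open>auto intro: a_in_G\<close>)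
  then have "h ** (mat2 1 v 0 1 ** h' ** mat2 1 v 0 1) \<in> H"
    using subgroup.m_closed[OF subgroup_H h] by simp
  \<comment> \<open>Here \<open>a(v)\<close> is replaced by \<open>a(t) a(v) a(t)\<close>, whose
    outer factors turn \<open>h\<close> and \<open>h'\<close> into \<open>g\<close> and
    \<open>g'\<close>.\<close>
  also have "h ** (mat2 1 v 0 1 ** h' ** mat2 1 v 0 1) =
      h ** (mat2 1 t 0 1 ** mat2 1 v 0 1 ** mat2 1 t 0 1) ** h' ** mat2 1 v 0 1"
    by (simp add: matrix_mul_assoc add.commute)
  also have "\<dots> = g ** mat2 1 v 0 1 ** g' ** mat2 1 v 0 1"
    unfolding ge g' by (simp only: matrix_mul_assoc)
  finally show ?thesis .
qed

lemma normal_eq_G: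
  assumes nontriv: "H \<noteq> {\<one>\<^bsub>SG\<^esub>}" and c: "c \<noteq> 0" "c \<noteq> (1::'k)"
  shows "H = G"
proof
  \<comment> \<open>A square is sure to lie in \<open>L\<close>; it differs from 1 because squaring
    is injective in characteristic 2.\<close>
  define s where "s = c\<^sup>2"
  have s: "s \<in> D" "s \<noteq> 0" "1 + s \<noteq> 0"
  proof -
    show "s \<noteq> 0" using c by (simp add: s_def)
    have "s \<in> L" using squares_L by (auto simp: s_def squares_def)
    then show "s \<in> D" using \<open>s \<noteq> 0\<close> by (rule D_incl)
    show "1 + s \<noteq> 0"
      using c square_eq_one_iff[of c] by (metis add_eq_0_iff power2_eq_square s_def uminus_eq)
  qed
  have a: "mat2 1 v 0 1 \<in> H" if v: "v \<in> L" for v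
  proof -
    \<comment> \<open>Solves \<open>(1 + s * s) * u = v\<close>, where \<open>1 + s * s\<close> is
      the square of \<open>1 + s\<close>.\<close>
    define u where "u = inverse (1 + s) * (inverse (1 + s) * v)"
    have "u \<in> L" using v by (auto simp: u_def intro: L_square_mult)
    then have "mat2 s 0 0 (inverse s) ** mat2 1 u 0 1 ** mat2 (inverse s) 0 0 s ** mat2 1 u 0 1 \<in> H"
      using diag_in_G[OF s(1)] diag_in_G[OF D_inverse[OF s(1)]] s
      by (intro commutator_in_H[OF nontriv]) auto
    moreover have "u + s * (s * u) = v"
    proof -
      have "u + s * (s * u) = (1 + s) * ((1 + s) * u)" by (simp add: algebra_simps)
      moreover have "(1 + s) * (inverse (1 + s) * x) = x" for x
        using s(3) by (simp flip: mult.assoc)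
      ultimately show ?thesis by (simp only: u_def)
    qed
    ultimately show ?thesis using s by (simp add: ac_simps)
  qed
  have b: "mat2 1 0 v 1 \<in> H" if "v \<in> L" for v
    unfolding b_mat_conj by (rule H_conj[OF a[OF that] w_in_G w_in_G]) (simp add: w_mat_def)
  show "G \<subseteq> H"
    using a b by (intro subgroup_contains_G[OF subgroup_H]) (auto simp: a_mat_def b_mat_def)
qed (rule H_subset_G)

end

text \<open>The element \<open>c\<close> rules out the field of two elements, over which the group
  is the symmetric group on three letters.\<close>

lemma simple_SG:
  assumes "c \<noteq> 0" "c \<noteq> (1::'k)"
  shows "is_simple SG"
  unfolding is_simple_def
proof (intro conjI allI impI)
  have "w_mat \<noteq> (mat2 1 0 0 1 :: 'k ^ 2 ^ 2)" by (simp add: w_mat_def)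
  then show "carrier SG \<noteq> {\<one>\<^bsub>SG\<^esub>}" using w_in_G by auto
  show "H = carrier SG \<or> H = {\<one>\<^bsub>SG\<^esub>}" if "H \<lhd> SG" for H
    using normal_eq_G[OF that _ assms] by auto
qed (rule group_SG)

end

text \<open>Both 0 and 1 are p-th powers for p > 0, so any element outside the image of Frobenius
  will do.\<close>

lemma imperfect_field_nontrivial_element:
  assumes "imperfect_field TYPE('k::field)"
  obtains c :: "'k::field" where "c \<noteq> 0" "c \<noteq> 1"
proof -
  have "CHAR('k) > 0" "range (\<lambda>x::'k. x ^ CHAR('k)) \<noteq> UNIV"
    using assms by (auto simp: imperfect_field_def)
  then obtain c :: 'k where c: "\<And>x. c \<noteq> x ^ CHAR('k)" and pos: "CHAR('k) > 0" by blast
  show thesis using c[of 0] c[of 1] pos by (intro that[of c]) auto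
qed

theorem theorem4p2:
  fixes L :: "'k::field set"
  assumes "imperfect_field TYPE('k)" and "CHAR('k) = 2"
    and "0 \<in> L" and "\<And>x y. x \<in> L \<Longrightarrow> y \<in> L \<Longrightarrow> x + y \<in> L" and "\<And>x. x \<in> L \<Longrightarrow> - x \<in> L"
    and "squares \<subseteq> L"
    and "\<And>c x. c \<in> squares \<Longrightarrow> x \<in> L \<Longrightarrow> c * x \<in> L"
  shows "SL2_gen L = B_grp L \<union> ((B_grp L #>\<^bsub>SL2\<^esub> w_mat) <#>\<^bsub>SL2\<^esub> B_grp L)
    \<and> A_grp L = {M \<in> SL2_gen L. upper_unitriangular M}
    \<and> T_grp L = {M \<in> SL2_gen L. diagonal M}
    \<and> is_simple (SL2\<lparr>carrier := SL2_gen L\<rparr>)"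
proof -
  interpret square_module L using assms by unfold_locales
  obtain c :: 'k where "c \<noteq> 0" "c \<noteq> 1"
    using imperfect_field_nontrivial_element[OF assms(1)] .
  then show ?thesis
    using G_eq[unfolded big_cell_def] A_grp_eq T_grp_eq_diagonal simple_SG by blast
qed

end
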